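(* Let $\mathcal L=(\mathcal L_1,\mathcal L_2,\dots)$ be a sequence of classes of weighted graphs with $\mathcal L_1\subseteq\mathcal L_2\subseteq\cdots$, each of asymptotic dimension at most $n$. Let $\mathcal C$ be an $\mathcal L$-layerable class of weighted graphs. Then the asymptotic dimension of $\mathcal C$ is at most $n+1$. Moreover, suppose that $\mathcal C$ is $c$-linearly $\mathcal L$-layerable for some $c>0$. If there exist $a,b,d\ge0$ such that each class $\mathcal L_i$ has an $n$-dimensional control function $D_i$ with $D_i(r)\le ar+b(i-1)+d$ for every $r>0$, then $\mathcal C$ has asymptotic dimension at most $n+1$ of linear type; and if moreover $d=0$, then $\mathcal C$ has Assouad-Nagata dimension at most $n+1$.
   Context: A weighted graph $(G,\phi)$ is a finite simple graph with $\phi:E(G)\to\mathbb{R}^+$, identified with the pseudometric space $(V(G),d_{(G,\phi)})$ where $d_{(G,\phi)}(x,y)$ is the minimum total weight of a path between $x,y$ ($\infty$ if none). For $A\subseteq V(G)$, the weighted subgraph induced by $A$ is $(G[A],\phi|_{E(G[A])})$ with its own intrinsic distance. A real projection of $(G,\phi)$ is a map $L:V(G)\to\mathbb R$ with $|L(x)-L(y)|\le d_{(G,\phi)}(x,y)$ for all $x,y$. A set $A\subseteq V(G)$ is $(\infty,S)$-bounded with respect to $L$ if $|L(x)-L(x')|\le S$ for all $x,x'\in A$. $\mathcal C$ is $\mathcal L$-layerable if there is a function $f:\mathbb{R}^+\to\mathbb N$ such that every $(G,\phi)\in\mathcal C$ has a real projection $L$ such that for every $S>0$, every inclusion-maximal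 $(\infty,S)$-bounded set with respect to $L$ induces a weighted graph in $\mathcal L_{f(S)}$; it is $c$-linearly $\mathcal L$-layerable if moreover $f(S)\le\max\{cS,1\}$ for all $S>0$. For a pseudometric space, a family $\mathcal U$ of subsets is $D$-bounded if each member has diameter at most $D$, and $r$-disjoint if points in different members are at distance $>r$. $D_X:\mathbb{R}^+\to\mathbb{R}^+$ is an $n$-dimensional control function if for every $r>0$ there is a cover $\bigcup_{i=1}^{n+1}\mathcal U_i$ with each $\mathcal U_i$ $r$-disjoint and each member $D_X(r)$-bounded. A class has asymptotic dimension at most $n$ if a single $n$-dimensional control function works for all members; of linear type if moreover it can be chosen with $D(r)\le c'r+c'$ for a constant $c'>0$; Assouad-Nagata dimension at most $n$ if it can be chosen with $D(r)\le c'r$. *)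

theory Defs
  imports "HOL-Library.FuncSet" "HOL-Library.Extended_Real"
begin

record 'a wgraph =
  verts :: "'a set"
  edges :: "'a set set"
  weight :: "'a set \<Rightarrow> real"

text \<open>The weight function takes the value \<open>undefined\<close> outside the edge set (this is part of
  \<open>\<rightarrow>\<^sub>E\<close>), so that equality of records is equality of weighted graphs.\<close>

definition weighted_graph :: "'a wgraph \<Rightarrow> bool" where
  "weighted_graph G \<longleftrightarrow> finite (verts G) \<and> (\<forall>e\<in>edges G. e \<subseteq> verts G \<and> card e = 2) \<and>
     weight G \<in> edges G \<rightarrow>\<^sub>E {0<..}"

definition induced_wgraph :: "'a wgraph \<Rightarrow> 'a set \<Rightarrow> 'a wgraph" where
  "induced_wgraph G A =
     \<lparr>verts = A, edges = {e \<in> edges G. e \<subseteq> A}, weight = restrict (weight G) {e \<in> edges G. e \<subseteq> A}\<rparr>"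

definition is_path :: "'a wgraph \<Rightarrow> 'a \<Rightarrow> 'a list \<Rightarrow> 'a \<Rightarrow> bool" where
  "is_path G x p y \<longleftrightarrow> p \<noteq> [] \<and> hd p = x \<and> last p = y \<and> distinct p \<and> set p \<subseteq> verts G \<and>
     successively (\<lambda>u v. {u, v} \<in> edges G) p"

definition path_weight :: "'a wgraph \<Rightarrow> 'a list \<Rightarrow> real" where
  "path_weight G p = (\<Sum>(u, v)\<leftarrow>zip p (tl p). weight G {u, v})"

text \<open>A finite graph has only finitely many paths, so the infimum is a minimum if some path
  exists; otherwise it is \<open>\<infinity>\<close>.\<close>

definition wdist :: "'a wgraph \<Rightarrow> 'a \<Rightarrow> 'a \<Rightarrow> ereal" where
  "wdist G x y = (INF p\<in>{p. is_path G x p y}. ereal (path_weight G p))"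

definition real_projection :: "'a wgraph \<Rightarrow> ('a \<Rightarrow> real) \<Rightarrow> bool" where
  "real_projection G L \<longleftrightarrow>
     (\<forall>x\<in>verts G. \<forall>y\<in>verts G. ereal \<bar>L x - L y\<bar> \<le> wdist G x y)"

text \<open>\<open>(\<infinity>, S)\<close>-boundedness with respect to \<open>L\<close>.\<close>

definition inf_bounded :: "('a \<Rightarrow> real) \<Rightarrow> real \<Rightarrow> 'a set \<Rightarrow> bool" where
  "inf_bounded L S A \<longleftrightarrow> (\<forall>x\<in>A. \<forall>x'\<in>A. \<bar>L x - L x'\<bar> \<le> S)"

definition maximal_inf_bounded :: "'a wgraph \<Rightarrow> ('a \<Rightarrow> real) \<Rightarrow> real \<Rightarrow> 'a set \<Rightarrow> bool" where
  "maximal_inf_bounded G L S A \<longleftrightarrow> A \<subseteq> verts G \<and> inf_bounded L S A \<and>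
     (\<forall>B. B \<subseteq> verts G \<and> inf_bounded L S B \<and> A \<subseteq> B \<longrightarrow> B = A)"

text \<open>A sequence of classes is indexed by the integers from 1 on; the value at 0 is never used,
  whence the condition \<open>1 \<le> f S\<close>.\<close>

definition layerable_via ::
    "(real \<Rightarrow> nat) \<Rightarrow> (nat \<Rightarrow> 'a wgraph set) \<Rightarrow> 'a wgraph set \<Rightarrow> bool" where
  "layerable_via f \<L> \<C> \<longleftrightarrow> (\<forall>S>0. 1 \<le> f S) \<and>
     (\<forall>G\<in>\<C>. \<exists>L. real_projection G L \<and>
       (\<forall>S>0. \<forall>A. maximal_inf_bounded G L S A \<longrightarrow> induced_wgraph G A \<in> \<L> (f S)))"

definition layerable :: "(nat \<Rightarrow> 'a wgraph set) \<Rightarrow> 'a wgraph set \<Rightarrow> bool" where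
  "layerable \<L> \<C> \<longleftrightarrow> (\<exists>f. layerable_via f \<L> \<C>)"

definition linearly_layerable :: "real \<Rightarrow> (nat \<Rightarrow> 'a wgraph set) \<Rightarrow> 'a wgraph set \<Rightarrow> bool" where
  "linearly_layerable c \<L> \<C> \<longleftrightarrow>
     (\<exists>f. layerable_via f \<L> \<C> \<and> (\<forall>S>0. real (f S) \<le> max (c * S) 1))"

text \<open>Pseudometric spaces are given by a carrier \<open>X\<close> and a distance \<open>\<delta>\<close> with values in
  \<open>[0, \<infinity>]\<close>. Functions from positive reals to positive reals are functions on
  \<^typ>\<open>real\<close> whose values at nonpositive arguments are irrelevant.\<close>

definition family_bounded :: "('a \<Rightarrow> 'a \<Rightarrow> ereal) \<Rightarrow> real \<Rightarrow> 'a set set \<Rightarrow> bool" where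
  "family_bounded \<delta> D \<U> \<longleftrightarrow> (\<forall>U\<in>\<U>. \<forall>x\<in>U. \<forall>y\<in>U. \<delta> x y \<le> ereal D)"

definition family_disjoint :: "('a \<Rightarrow> 'a \<Rightarrow> ereal) \<Rightarrow> real \<Rightarrow> 'a set set \<Rightarrow> bool" where
  "family_disjoint \<delta> r \<U> \<longleftrightarrow>
     (\<forall>U\<in>\<U>. \<forall>V\<in>\<U>. U \<noteq> V \<longrightarrow> (\<forall>x\<in>U. \<forall>y\<in>V. ereal r < \<delta> x y))"

definition control_function ::
    "nat \<Rightarrow> 'a set \<Rightarrow> ('a \<Rightarrow> 'a \<Rightarrow> ereal) \<Rightarrow> (real \<Rightarrow> real) \<Rightarrow> bool" where
  "control_function n X \<delta> D \<longleftrightarrow> (\<forall>r>0. 0 < D r) \<and>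
     (\<forall>r>0. \<exists>\<U> :: nat \<Rightarrow> 'a set set.
        X = (\<Union>i\<in>{1..n+1}. \<Union>(\<U> i)) \<and>
        (\<forall>i\<in>{1..n+1}. family_disjoint \<delta> r (\<U> i) \<and> family_bounded \<delta> (D r) (\<U> i)))"

definition class_control_function :: "nat \<Rightarrow> 'a wgraph set \<Rightarrow> (real \<Rightarrow> real) \<Rightarrow> bool" where
  "class_control_function n \<C> D \<longleftrightarrow>
     (\<forall>r>0. 0 < D r) \<and> (\<forall>G\<in>\<C>. control_function n (verts G) (wdist G) D)"

definition asdim_at_most :: "nat \<Rightarrow> 'a wgraph set \<Rightarrow> bool" where
  "asdim_at_most n \<C> \<longleftrightarrow> (\<exists>D. class_control_function n \<C> D)"

definition asdim_at_most_linear_type :: "nat \<Rightarrow> 'a wgraph set \<Rightarrow> bool" where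
  "asdim_at_most_linear_type n \<C> \<longleftrightarrow>
     (\<exists>D. class_control_function n \<C> D \<and> (\<exists>c>0. \<forall>r>0. D r \<le> c * r + c))"

definition assouad_nagata_dim_at_most :: "nat \<Rightarrow> 'a wgraph set \<Rightarrow> bool" where
  "assouad_nagata_dim_at_most n \<C> \<longleftrightarrow>
     (\<exists>D. class_control_function n \<C> D \<and> (\<exists>c>0. \<forall>r>0. D r \<le> c * r))"

end

theory Submission
  imports Defs
begin

text \<open>Cut the graph along the projection \<open>L\<close> into rows of height \<open>e = 4 (n + 1) r\<close>. Even rows are
  covered by \<open>n + 1\<close> colours at scale \<open>r\<close> with bound \<open>D\<^sub>0\<close>, odd rows at the larger scale
  \<open>2 D\<^sub>0 + 3 r\<close>. In the even rows, colour \<open>k\<close> is removed from a strip of height \<open>2 r\<close>, the strips of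
  different colours being more than \<open>r\<close> apart; the removed pieces together form the new colour
  \<open>n + 2\<close>. Between two consecutive cuts of colour \<open>k\<close> there is only one odd row, and each of its sets
  of colour \<open>k\<close> absorbs the nearby even pieces of that colour; the scale of the odd rows keeps the
  results \<open>r\<close>-disjoint, and the cuts prevent the absorption from propagating from row to row.

  Passing from a layer to its intrinsic metric is harmless: a path of weight at most \<open>r\<close> leaves a
  layer by at most \<open>r\<close>, so one works in the layer thickened by \<open>r\<close>.\<close>

section \<open>Saturated unions of families in a pseudometric space\<close>

definition saturate :: "('a \<Rightarrow> 'a \<Rightarrow> ereal) \<Rightarrow> real \<Rightarrow> 'a set set \<Rightarrow> 'a set \<Rightarrow> 'a set" where
  "saturate \<delta> r \<U> V = V \<union> \<Union>{U \<in> \<U>. \<exists>x\<in>U. \<exists>y\<in>V. \<delta> x y \<le> ereal r}"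

text \<open>This is the saturated union known from union theorems for asymptotic dimension. A member
  of \<open>\<U>\<close> within \<open>r\<close> of some set of \<open>\<V>\<close> survives only
  inside saturated sets; every other member is kept as it is.\<close>

definition saturated_union ::
    "('a \<Rightarrow> 'a \<Rightarrow> ereal) \<Rightarrow> real \<Rightarrow> 'a set set \<Rightarrow> 'a set set \<Rightarrow> 'a set set" where
  "saturated_union \<delta> r \<U> \<V> =
     saturate \<delta> r \<U> ` \<V> \<union> {U \<in> \<U>. \<forall>V\<in>\<V>. \<forall>x\<in>U. \<forall>y\<in>V. ereal r < \<delta> x y}"

text \<open>A member of \<open>\<U>\<close> that is not kept is near some \<open>V\<close> and hence
  absorbed by its saturation, so the regrouping loses no point.\<close>

lemma Union_saturated_union: "\<Union>(saturated_union \<delta> r \<U> \<V>) = \<Union>\<U> \<union> \<Union>\<V>"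
proof
  show "\<Union>(saturated_union \<delta> r \<U> \<V>) \<subseteq> \<Union>\<U> \<union> \<Union>\<V>"
    unfolding saturated_union_def saturate_def by blast
  show "\<Union>\<U> \<union> \<Union>\<V> \<subseteq> \<Union>(saturated_union \<delta> r \<U> \<V>)"
  proof
    fix x assume "x \<in> \<Union>\<U> \<union> \<Union>\<V>"
    then consider V where "x \<in> V" "V \<in> \<V>" | U where "x \<in> U" "U \<in> \<U>" by blast
    then show "x \<in> \<Union>(saturated_union \<delta> r \<U> \<V>)"
    proof cases
      case 1
      then show ?thesis unfolding saturated_union_def saturate_def by blast
    next
      case 2
      show ?thesis
      proof (cases "\<forall>V\<in>\<V>. \<forall>x\<in>U. \<forall>y\<in>V. ereal r < \<delta> x y")
        case True
        with 2 show ?thesis unfolding saturated_union_def by blast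
      next
        case False
        then obtain V u v where "V \<in> \<V>" "u \<in> U" "v \<in> V" "\<delta> u v \<le> ereal r"
          by (meson not_less)
        then have "V \<in> \<V>" "x \<in> saturate \<delta> r \<U> V" using 2 unfolding saturate_def by blast+
        then show ?thesis unfolding saturated_union_def by blast
      qed
    qed
  qed
qed

locale pseudometric =
  fixes X :: "'a set" and \<delta> :: "'a \<Rightarrow> 'a \<Rightarrow> ereal"
  assumes refl: "x \<in> X \<Longrightarrow> \<delta> x x \<le> 0"
    and sym: "\<lbrakk>x \<in> X; y \<in> X\<rbrakk> \<Longrightarrow> \<delta> x y = \<delta> y x"
    and tri: "\<lbrakk>x \<in> X; y \<in> X; z \<in> X\<rbrakk> \<Longrightarrow> \<delta> x z \<le> \<delta> x y + \<delta> y z"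
begin

lemma tri_le:
  assumes "x \<in> X" "y \<in> X" "z \<in> X" "\<delta> x y \<le> ereal a" "\<delta> y z \<le> ereal b"
  shows "\<delta> x z \<le> ereal (a + b)"
  using tri[OF assms(1-3)] add_mono[OF assms(4,5)] by simp

text \<open>A point gained by saturation shares a set of diameter at most \<open>D0\<close> with a
  point that lies within \<open>r\<close> of \<open>V\<close>; a point of \<open>V\<close> is its
  own witness.\<close>

lemma saturate_near:
  assumes \<U>: "\<Union>\<U> \<subseteq> X" "family_bounded \<delta> D0 \<U>" and V: "V \<subseteq> X"
    and "0 \<le> D0" "0 \<le> r" and x: "x \<in> saturate \<delta> r \<U> V"
  obtains v where "v \<in> V" "\<delta> x v \<le> ereal (D0 + r)"
proof (cases "x \<in> V")
  case True
  have "\<delta> x x \<le> 0" using refl True V by blast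
  also have "0 \<le> ereal (D0 + r)" using assms by simp
  finally have "\<delta> x x \<le> ereal (D0 + r)" .
  with True that show ?thesis by blast
next
  case False
  then obtain U u v where "U \<in> \<U>" "x \<in> U" "u \<in> U" "v \<in> V" "\<delta> u v \<le> ereal r"
    using x unfolding saturate_def by blast
  moreover from this have "\<delta> x u \<le> ereal D0" using \<U>(2) unfolding family_bounded_def by blast
  ultimately show ?thesis using tri_le[of x u v D0 r] \<U>(1) V that by blast
qed

text \<open>Two points of one saturated set are joined through \<open>V\<close> at cost
  \<open>(D0 + r) + D1 + (D0 + r)\<close>; a kept member has diameter at most
  \<open>D0\<close>.\<close>

lemma saturated_union_bounded:
  assumes \<U>: "\<Union>\<U> \<subseteq> X" "family_bounded \<delta> D0 \<U>" and \<V>: "\<Union>\<V> \<subseteq> X" "family_bounded \<delta> D1 \<V>"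
    and nn: "0 \<le> D0" "0 \<le> D1" "0 \<le> r"
  shows "family_bounded \<delta> (D1 + 2 * D0 + 2 * r) (saturated_union \<delta> r \<U> \<V>)"
  unfolding family_bounded_def
proof (intro ballI)
  fix A x y assume A: "A \<in> saturated_union \<delta> r \<U> \<V>" and xy: "x \<in> A" "y \<in> A"
  from A consider V where "V \<in> \<V>" "A = saturate \<delta> r \<U> V" | "A \<in> \<U>"
    unfolding saturated_union_def by blast
  then show "\<delta> x y \<le> ereal (D1 + 2 * D0 + 2 * r)"
  proof cases
    case 1
    have V: "V \<subseteq> X" using 1 \<V> by blast
    obtain v where v: "v \<in> V" "\<delta> x v \<le> ereal (D0 + r)"
      using saturate_near[OF \<U> V nn(1,3)] xy 1 by blast
    obtain w where w: "w \<in> V" "\<delta> y w \<le> ereal (D0 + r)"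
      using saturate_near[OF \<U> V nn(1,3)] xy 1 by blast
    have X: "x \<in> X" "y \<in> X" "v \<in> X" "w \<in> X"
      using xy 1 v w V \<U>(1) unfolding saturate_def by blast+
    have "\<delta> v w \<le> ereal D1" using v w 1 \<V>(2) unfolding family_bounded_def by blast
    then have "\<delta> x w \<le> ereal (D0 + r + D1)" using tri_le X v by blast
    moreover have "\<delta> w y \<le> ereal (D0 + r)" using w sym X by simp
    ultimately have "\<delta> x y \<le> ereal ((D0 + r + D1) + (D0 + r))" using tri_le X by blast
    then show ?thesis by (simp add: algebra_simps)
  next
    case 2
    then have "\<delta> x y \<le> ereal D0" using xy \<U>(2) unfolding family_bounded_def by blast
    also have "\<dots> \<le> ereal (D1 + 2 * D0 + 2 * r)" using nn by simp
    finally show ?thesis .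
  qed
qed

text \<open>If two saturations came within \<open>r\<close> of each other, the underlying sets
  \<open>V\<close> and \<open>W\<close> would have points at distance at most
  \<open>(D0 + r) + r + (D0 + r)\<close>; hence the scale \<open>2 * D0 + 3 * r\<close>. A kept
  member is far from \<open>V\<close> itself and differs from every absorbed member, so
  \<open>r\<close>-disjointness of \<open>\<U>\<close> separates it from the rest of the
  saturation.\<close>

lemma saturated_union_disjoint:
  assumes \<U>: "\<Union>\<U> \<subseteq> X" "family_bounded \<delta> D0 \<U>" "family_disjoint \<delta> r \<U>"
    and \<V>: "\<Union>\<V> \<subseteq> X" "family_disjoint \<delta> (2 * D0 + 3 * r) \<V>"
    and nn: "0 \<le> D0" "0 \<le> r"
  shows "family_disjoint \<delta> r (saturated_union \<delta> r \<U> \<V>)"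
proof -
  have VV: "ereal r < \<delta> x y"
    if *: "V \<in> \<V>" "W \<in> \<V>" "V \<noteq> W" "x \<in> saturate \<delta> r \<U> V" "y \<in> saturate \<delta> r \<U> W" for V W x y
  proof (rule ccontr)
    assume "\<not> ereal r < \<delta> x y"
    then have d: "\<delta> x y \<le> ereal r" by simp
    have VX: "V \<subseteq> X" "W \<subseteq> X" using that \<V>(1) by blast+
    obtain v where v: "v \<in> V" "\<delta> x v \<le> ereal (D0 + r)"
      using saturate_near[OF \<U>(1,2) VX(1) nn] * by blast
    obtain w where w: "w \<in> W" "\<delta> y w \<le> ereal (D0 + r)"
      using saturate_near[OF \<U>(1,2) VX(2) nn] * by blast
    have X: "x \<in> X" "y \<in> X" "v \<in> X" "w \<in> X"
      using that v w VX \<U>(1) unfolding saturate_def by blast+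
    have "\<delta> v x \<le> ereal (D0 + r)" using v sym X by simp
    then have "\<delta> v y \<le> ereal (D0 + r + r)" using tri_le X d by blast
    then have "\<delta> v w \<le> ereal ((D0 + r + r) + (D0 + r))" using tri_le X w by blast
    then have "\<delta> v w \<le> ereal (2 * D0 + 3 * r)" by (simp add: algebra_simps)
    moreover have "ereal (2 * D0 + 3 * r) < \<delta> v w"
      using \<V>(2) v w that unfolding family_disjoint_def by blast
    ultimately show False by simp
  qed
  have VU: "ereal r < \<delta> x y"
    if VU: "V \<in> \<V>" "x \<in> saturate \<delta> r \<U> V" "U \<in> \<U>" "y \<in> U"
      and far: "\<forall>V\<in>\<V>. \<forall>x\<in>U. \<forall>y\<in>V. ereal r < \<delta> x y" for V U x y
  proof (cases "x \<in> V")
    case True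
    then have "ereal r < \<delta> y x" using far that by blast
    moreover have "\<delta> x y = \<delta> y x" by (rule sym) (use True that \<U>(1) \<V>(1) in blast)+
    ultimately show ?thesis by simp
  next
    case False
    then obtain U' u v where *: "U' \<in> \<U>" "x \<in> U'" "u \<in> U'" "v \<in> V" "\<delta> u v \<le> ereal r"
      using VU unfolding saturate_def by blast
    then have "U \<noteq> U'" using far \<open>V \<in> \<V>\<close> by force
    then show ?thesis using \<U>(3) * that unfolding family_disjoint_def by blast
  qed
  have UX: "U \<subseteq> X" if "U \<in> saturated_union \<delta> r \<U> \<V>" for U
    using that Union_saturated_union[of \<delta> r \<U> \<V>] \<U>(1) \<V>(1) by blast
  show ?thesis
    unfolding family_disjoint_def
  proof (intro ballI impI)
    fix A B x y
    assume A: "A \<in> saturated_union \<delta> r \<U> \<V>" and B: "B \<in> saturated_union \<delta> r \<U> \<V>"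
      and ne: "A \<noteq> B" and x: "x \<in> A" and y: "y \<in> B"
    let ?far = "\<lambda>U. \<forall>V\<in>\<V>. \<forall>x\<in>U. \<forall>y\<in>V. ereal r < \<delta> x y"
    have A': "(\<exists>V\<in>\<V>. A = saturate \<delta> r \<U> V) \<or> A \<in> \<U> \<and> ?far A"
      using A unfolding saturated_union_def by blast
    have B': "(\<exists>V\<in>\<V>. B = saturate \<delta> r \<U> V) \<or> B \<in> \<U> \<and> ?far B"
      using B unfolding saturated_union_def by blast
    have s: "\<delta> x y = \<delta> y x" using UX A B x y sym by blast
    from A' B' show "ereal r < \<delta> x y"
    proof (elim disjE)
      assume "\<exists>V\<in>\<V>. A = saturate \<delta> r \<U> V" "\<exists>V\<in>\<V>. B = saturate \<delta> r \<U> V"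
      then show ?thesis using VV x y ne by blast
    next
      assume "\<exists>V\<in>\<V>. A = saturate \<delta> r \<U> V" "B \<in> \<U> \<and> ?far B"
      then show ?thesis using VU x y by blast
    next
      assume "A \<in> \<U> \<and> ?far A" "\<exists>V\<in>\<V>. B = saturate \<delta> r \<U> V"
      then have "ereal r < \<delta> y x" using VU x y by blast
      then show ?thesis using s by simp
    next
      assume "A \<in> \<U> \<and> ?far A" "B \<in> \<U> \<and> ?far B"
      then show ?thesis using \<U>(3) x y ne unfolding family_disjoint_def by blast
    qed
  qed
qed

end

section \<open>Families of sets, layers, and the gluing of covers along a projection\<close>

lemma family_disjoint_UN:
  assumes "\<And>i. i \<in> I \<Longrightarrow> family_disjoint \<delta> r (F i)"
    and "\<And>i j x y. \<lbrakk>i \<in> I; j \<in> I; i \<noteq> j; x \<in> \<Union>(F i); y \<in> \<Union>(F j)\<rbrakk> \<Longrightarrow> ereal r < \<delta> x y"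
  shows "family_disjoint \<delta> r (\<Union>i\<in>I. F i)"
  unfolding family_disjoint_def
proof (intro ballI impI)
  fix U V x y assume "U \<in> (\<Union>i\<in>I. F i)" "V \<in> (\<Union>i\<in>I. F i)" "U \<noteq> V" "x \<in> U" "y \<in> V"
  then obtain i j where "i \<in> I" "U \<in> F i" "j \<in> I" "V \<in> F j" by blast
  note * = this \<open>U \<noteq> V\<close> \<open>x \<in> U\<close> \<open>y \<in> V\<close>
  show "ereal r < \<delta> x y"
  proof (cases "i = j")
    case True
    then show ?thesis using assms(1)[of i] * unfolding family_disjoint_def by blast
  next
    case False
    show ?thesis by (rule assms(2)[of i j]) (use False * in blast)+
  qed
qed

lemma family_bounded_UN:
  "(\<And>i. i \<in> I \<Longrightarrow> family_bounded \<delta> D (F i)) \<Longrightarrow> family_bounded \<delta> D (\<Union>i\<in>I. F i)"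
  unfolding family_bounded_def by blast

lemma family_bounded_mono:
  assumes "family_bounded \<delta> D F" "D \<le> D'" shows "family_bounded \<delta> D' F"
  using assms unfolding family_bounded_def by (meson ereal_less_eq(3) order_trans)

lemma family_disjoint_image_Int:
  "family_disjoint \<delta> r F \<Longrightarrow> family_disjoint \<delta> r ((\<lambda>U. U \<inter> A) ` F)"
  unfolding family_disjoint_def by blast

lemma family_bounded_image_Int:
  "family_bounded \<delta> D F \<Longrightarrow> family_bounded \<delta> D ((\<lambda>U. U \<inter> A) ` F)"
  unfolding family_bounded_def by blast

text \<open>Both ends are closed, so neighbouring rows share their common level; this is harmless
  because the sets of a cover may overlap.\<close>

definition layer :: "'a set \<Rightarrow> ('a \<Rightarrow> real) \<Rightarrow> real \<Rightarrow> real \<Rightarrow> 'a set" where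
  "layer X L s t = {x \<in> X. s \<le> L x \<and> L x \<le> t}"

text \<open>The condition inside \<open>control_function\<close> at a single scale, with
  \<open>r\<close> and the bound \<open>D\<close> as independent arguments, since the gluing
  combines two scales with different bounds.\<close>

definition covered_by ::
    "nat \<Rightarrow> 'a set \<Rightarrow> ('a \<Rightarrow> 'a \<Rightarrow> ereal) \<Rightarrow> real \<Rightarrow> real \<Rightarrow> (nat \<Rightarrow> 'a set set) \<Rightarrow> bool" where
  "covered_by n X \<delta> r D \<U> \<longleftrightarrow> X = (\<Union>i\<in>{1..n+1}. \<Union>(\<U> i)) \<and>
     (\<forall>i\<in>{1..n+1}. family_disjoint \<delta> r (\<U> i) \<and> family_bounded \<delta> D (\<U> i))"

lemma control_function_iff:
  "control_function n X \<delta> D \<longleftrightarrow> (\<forall>r>0. 0 < D r) \<and> (\<forall>r>0. \<exists>\<U>. covered_by n X \<delta> r (D r) \<U>)"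
  unfolding control_function_def covered_by_def ..

text \<open>The cuts of the \<open>n + 1\<close> colours follow each other with period
  \<open>4 * r\<close>, which gives a row its height \<open>e\<close>; \<open>P\<close> is the
  height of an even and an odd row together. The final bound is the one of
  \<open>saturated_union_bounded\<close>.\<close>

lemma (in pseudometric) cover_of_layers:
  fixes L :: "'a \<Rightarrow> real" and r D0 D1 :: real and n :: nat
    and UE VO :: "int \<Rightarrow> nat \<Rightarrow> 'a set set"
  defines "e \<equiv> 4 * (real n + 1) * r"
  defines "P \<equiv> 2 * e"
  assumes lip: "\<And>x y. \<lbrakk>x \<in> X; y \<in> X\<rbrakk> \<Longrightarrow> ereal \<bar>L x - L y\<bar> \<le> \<delta> x y"
    and pos: "0 < r" "0 \<le> D0" "0 \<le> D1"
    and UE: "\<And>j. covered_by n (layer X L (real_of_int j * P) (real_of_int j * P + e))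
      \<delta> r D0 (UE j)"
    and VO: "\<And>j. covered_by n (layer X L (real_of_int j * P + e) (real_of_int j * P + e + e))
      \<delta> (2 * D0 + 3 * r) D1 (VO j)"
  shows "\<exists>\<U>. covered_by (n + 1) X \<delta> r (D1 + 2 * D0 + 2 * r) \<U>"
proof -
  \<comment> \<open>Along \<open>L\<close>, colour \<open>k\<close> alternates between closed strips
    of height \<open>2 * r\<close> and open slabs: \<open>slab k j\<close> fills the gap between
    \<open>strip k j\<close> and \<open>strip k (j + 1)\<close>. For \<open>k\<close> from
    \<open>1\<close> to \<open>n + 1\<close>, \<open>strip k j\<close> lies inside even row
    \<open>j\<close>, and \<open>slab k j\<close> consists of the part of that row above the strip,
    the whole odd row \<open>j\<close>, and the part of even row \<open>j + 1\<close> below the next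
    strip.\<close>
  define slab where "slab k j = {x. real_of_int j * P + 4 * real k * r - r < L x \<and>
      L x < real_of_int j * P + P + 4 * real k * r - 3 * r}" for k :: nat and j :: int
  define strip where "strip k j = {x. real_of_int j * P + 4 * real k * r - 3 * r \<le> L x \<and>
      L x \<le> real_of_int j * P + 4 * real k * r - r}" for k :: nat and j :: int
  \<comment> \<open>The indices \<open>j\<close> and \<open>j + 1\<close> are those of the only even
    rows that \<open>slab k j\<close> meets.\<close>
  define FE where "FE k j = (\<lambda>U. U \<inter> slab k j) ` (\<Union>i\<in>{j, j+1}. UE i k)" for k j
  define F where "F k j = saturated_union \<delta> r (FE k j) (VO j k)" for k j
  define H where "H k j = (\<lambda>U. U \<inter> strip k j) ` UE j k" for k j
  \<comment> \<open>The second branch is the new colour \<open>n + 2\<close>, made of all pieces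
    that the strips cut out of the even rows.\<close>
  define \<U> where "\<U> k = (if k \<le> n + 1 then \<Union>j\<in>UNIV. F k j
      else \<Union>(k, j)\<in>{1..n+1} \<times> UNIV. H k j)" for k
  have e: "4 * r \<le> e" "0 < e" using pos by (auto simp: e_def mult_le_cancel_right1)
  have P: "P = e + e" by (simp add: P_def)
  have far: "ereal r < \<delta> x y" if "x \<in> X" "y \<in> X" "r < L y - L x \<or> r < L x - L y" for x y
  proof -
    have "ereal r < ereal \<bar>L x - L y\<bar>" using that by auto
    then show ?thesis using lip that(1,2) by (meson less_le_trans)
  qed
  have kr: "4 * r \<le> 4 * real k * r" "4 * real k * r \<le> e" if "k \<in> {1..n+1}" for k
  proof -
    show "4 * r \<le> 4 * real k * r" using that pos by (simp add: mult_le_cancel_right1)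
    show "4 * real k * r \<le> e" unfolding e_def using that pos by (intro mult_right_mono) auto
  qed
  have jP: "real_of_int i * P + P \<le> real_of_int j * P" if "i < j" for i j :: int
  proof -
    have "real_of_int i + 1 \<le> real_of_int j" using that by linarith
    then have "(real_of_int i + 1) * P \<le> real_of_int j * P"
      using e by (intro mult_right_mono) (auto simp: P_def)
    then show ?thesis by (simp add: algebra_simps)
  qed
  have kk: "4 * real k * r + 4 * r \<le> 4 * real l * r" if "k < l" for k l :: nat
  proof -
    have "real k + 1 \<le> real l" using that by linarith
    then have "(real k + 1) * (4 * r) \<le> real l * (4 * r)"
      using pos by (intro mult_right_mono) auto
    then show ?thesis by (simp add: algebra_simps)
  qed
  have UEX: "\<Union>(UE j k) \<subseteq> layer X L (real_of_int j * P) (real_of_int j * P + e)"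
    if "k \<in> {1..n+1}" for j k
    using UE[of j] that unfolding covered_by_def by blast
  have VOX: "\<Union>(VO j k) \<subseteq> layer X L (real_of_int j * P + e) (real_of_int j * P + e + e)"
    if "k \<in> {1..n+1}" for j k
    using VO[of j] that unfolding covered_by_def by blast
  have layerX: "layer X L s t \<subseteq> X" for s t unfolding layer_def by blast
  \<comment> \<open>Between two even rows lies an odd row of height \<open>e\<close>, which is at
    least \<open>4 * r\<close>.\<close>
  have rows: "ereal r < \<delta> x y"
    if xy: "x \<in> layer X L (real_of_int i * P) (real_of_int i * P + e)"
      "y \<in> layer X L (real_of_int j * P) (real_of_int j * P + e)" and "i \<noteq> j"
    for i j :: int and x y
  proof (rule far)
    show "x \<in> X" "y \<in> X" using xy layerX by blast+
    consider "i < j" | "j < i" using \<open>i \<noteq> j\<close> by linarith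
    then show "r < L y - L x \<or> r < L x - L y"
    proof cases
      case 1
      show ?thesis
        using jP[OF 1] xy e pos P unfolding layer_def mem_Collect_eq by (elim conjE) linarith
    next
      case 2
      show ?thesis
        using jP[OF 2] xy e pos P unfolding layer_def mem_Collect_eq by (elim conjE) linarith
    qed
  qed
  have FEX: "\<Union>(FE k j) \<subseteq> X \<inter> slab k j" if "k \<in> {1..n+1}" for k j
    using UEX[OF that] layerX unfolding FE_def by blast
  \<comment> \<open>Since \<open>4 * real k * r\<close> lies between \<open>4 * r\<close> and
    \<open>e\<close>, no cut touches an odd row. Its sets, saturated by pieces from the same slab,
    therefore stay in that slab.\<close>
  have VOslab: "\<Union>(VO j k) \<subseteq> X \<inter> slab k j" if k: "k \<in> {1..n+1}" for k j
  proof
    fix x assume "x \<in> \<Union>(VO j k)"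
    then have "x \<in> layer X L (real_of_int j * P + e) (real_of_int j * P + e + e)"
      using VOX[OF k] by blast
    then show "x \<in> X \<inter> slab k j"
      using kr[OF k] pos P unfolding slab_def layer_def mem_Collect_eq Int_iff
      by (elim conjE, intro conjI; linarith)
  qed
  have FX: "\<Union>(F k j) \<subseteq> X \<inter> slab k j" if "k \<in> {1..n+1}" for k j
    using FEX[OF that, of j] VOslab[OF that, of j] unfolding F_def Union_saturated_union by blast
  have FEd: "family_disjoint \<delta> r (FE k j)" if k: "k \<in> {1..n+1}" for k j
    unfolding FE_def
  proof (intro family_disjoint_image_Int family_disjoint_UN)
    show "family_disjoint \<delta> r (UE i k)" for i using UE k unfolding covered_by_def by blast
  qed (use UEX[OF k] rows in blast)
  have FEb: "family_bounded \<delta> D0 (FE k j)" if k: "k \<in> {1..n+1}" for k j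
    unfolding FE_def
  proof (intro family_bounded_image_Int family_bounded_UN)
    show "family_bounded \<delta> D0 (UE i k)" for i using UE k unfolding covered_by_def by blast
  qed
  have Fd: "family_disjoint \<delta> r (F k j)" and Fb: "family_bounded \<delta> (D1 + 2 * D0 + 2 * r) (F k j)"
    if k: "k \<in> {1..n+1}" for k j
  proof -
    have *: "\<Union>(FE k j) \<subseteq> X" "\<Union>(VO j k) \<subseteq> X"
      "family_disjoint \<delta> (2 * D0 + 3 * r) (VO j k)" "family_bounded \<delta> D1 (VO j k)"
      using FEX[OF k] VOslab[OF k] VO[of j] k unfolding covered_by_def by blast+
    show "family_disjoint \<delta> r (F k j)" unfolding F_def
      using saturated_union_disjoint[OF *(1) FEb[OF k] FEd[OF k] *(2,3)] pos by simp
    show "family_bounded \<delta> (D1 + 2 * D0 + 2 * r) (F k j)" unfolding F_def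
      using saturated_union_bounded[OF *(1) FEb[OF k] *(2,4)] pos by simp
  qed
  \<comment> \<open>Two slabs of one colour are separated by a strip of height
    \<open>2 * r\<close>.\<close>
  have slabs: "ereal r < \<delta> x y" if "x \<in> X \<inter> slab k i" "y \<in> X \<inter> slab k j" "i \<noteq> j" for x y k i j
  proof (rule far)
    show "x \<in> X" "y \<in> X" using that by blast+
    consider "i < j" | "j < i" using \<open>i \<noteq> j\<close> by linarith
    then show "r < L y - L x \<or> r < L x - L y"
    proof cases
      case 1
      show ?thesis
        using jP[OF 1] that pos unfolding slab_def mem_Collect_eq Int_iff by (elim conjE) linarith
    next
      case 2
      show ?thesis
        using jP[OF 2] that pos unfolding slab_def mem_Collect_eq Int_iff by (elim conjE) linarith
    qed
  qed
  have HX: "\<Union>(H k j) \<subseteq> layer X L (real_of_int j * P) (real_of_int j * P + e) \<inter> strip k j"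
    if "k \<in> {1..n+1}" for k j
    using UEX[OF that] unfolding H_def by blast
  \<comment> \<open>Within one row, consecutive strips start \<open>4 * r\<close> apart and have
    height \<open>2 * r\<close>, which leaves a gap of \<open>2 * r\<close>. In different rows the
    separation of the rows suffices.\<close>
  have strips: "ereal r < \<delta> x y"
    if x: "x \<in> layer X L (real_of_int i * P) (real_of_int i * P + e) \<inter> strip k i"
      and y: "y \<in> layer X L (real_of_int j * P) (real_of_int j * P + e) \<inter> strip l j"
      and ne: "(k, i) \<noteq> (l, j)"
    for x y k l i j
  proof (cases "i = j")
    case True
    show ?thesis
    proof (rule far)
      show "x \<in> X" "y \<in> X" using x y layerX by blast+
      consider "k < l" | "l < k" using ne True by force
      then show "r < L y - L x \<or> r < L x - L y"
      proof cases
        case 1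
        show ?thesis
          using kk[OF 1] x y pos unfolding True strip_def mem_Collect_eq Int_iff
          by (elim conjE) linarith
      next
        case 2
        show ?thesis
          using kk[OF 2] x y pos unfolding True strip_def mem_Collect_eq Int_iff
          by (elim conjE) linarith
      qed
    qed
  qed (use rows x y in blast)
  have Hd: "family_disjoint \<delta> r (H k j)" and Hb: "family_bounded \<delta> D0 (H k j)"
    if k: "k \<in> {1..n+1}" for k j
    unfolding H_def using UE[of j] k unfolding covered_by_def
    by (auto intro!: family_disjoint_image_Int family_bounded_image_Int)
  have U1: "\<U> k = (\<Union>j\<in>UNIV. F k j)" if "k \<in> {1..n+1}" for k using that by (simp add: \<U>_def)
  have U2: "\<U> (n + 2) = (\<Union>(k, j)\<in>{1..n+1} \<times> UNIV. H k j)" by (simp add: \<U>_def)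
  have range: "{1..n+1+1} = insert (n + 2) {1..n+1}" by auto
  have cover: "x \<in> \<Union>(\<U> (n + 2)) \<or> (\<exists>k\<in>{1..n+1}. x \<in> \<Union>(\<U> k))" if x: "x \<in> X" for x
  proof -
    \<comment> \<open>The floor selects the period that contains \<open>L x\<close>; its lower half
      is even row \<open>j\<close>, its upper half odd row \<open>j\<close>.\<close>
    define j where "j = \<lfloor>L x / P\<rfloor>"
    have P0: "0 < P" using e by (simp add: P_def)
    have lo: "real_of_int j * P \<le> L x" and hi: "L x \<le> real_of_int j * P + P"
    proof -
      have "j \<le> L x / P" "L x / P \<le> j + 1" unfolding j_def by linarith+
      then show "real_of_int j * P \<le> L x" "L x \<le> real_of_int j * P + P"
        using P0 by (simp_all add: field_simps)
    qed
    show ?thesis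
    proof (cases "L x \<le> real_of_int j * P + e")
      case True
      then have "x \<in> layer X L (real_of_int j * P) (real_of_int j * P + e)"
        using x lo by (simp add: layer_def)
      then obtain k U where k: "k \<in> {1..n+1}" and U: "x \<in> U" "U \<in> UE j k"
        using UE[of j] unfolding covered_by_def by blast
      \<comment> \<open>The point lies in the strip of its colour, above it, or below it; below it,
        the relevant slab is the one that started in the previous period.\<close>
      consider "x \<in> strip k j" | "x \<in> slab k j" | "x \<in> slab k (j - 1)"
      proof -
        have "real_of_int (j - 1) * P + P = real_of_int j * P" by (simp add: algebra_simps)
        then show thesis
          using that True lo hi kr[OF k] pos P unfolding strip_def slab_def mem_Collect_eq by linarith
      qed
      then show ?thesis
      proof cases
        case 1
        then have "x \<in> \<Union>(H k j)" using U unfolding H_def by blast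
        then show ?thesis using k unfolding U2 by blast
      next
        case 2
        then have "x \<in> \<Union>(FE k j)" using U unfolding FE_def by blast
        then have "x \<in> \<Union>(F k j)" unfolding F_def Union_saturated_union by blast
        then show ?thesis using k U1 by blast
      next
        case 3
        then have "x \<in> \<Union>(FE k (j - 1))" using U unfolding FE_def by auto
        then have "x \<in> \<Union>(F k (j - 1))" unfolding F_def Union_saturated_union by blast
        then show ?thesis using k U1 by blast
      qed
    next
      case False
      then have "x \<in> layer X L (real_of_int j * P + e) (real_of_int j * P + e + e)"
        using x hi by (simp add: layer_def P_def)
      then obtain k where k: "k \<in> {1..n+1}" and "x \<in> \<Union>(VO j k)"
        using VO[of j] unfolding covered_by_def by blast
      then have "x \<in> \<Union>(F k j)" unfolding F_def Union_saturated_union by blast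
      then show ?thesis using k U1 by blast
    qed
  qed
  have sub: "\<Union>(\<U> k) \<subseteq> X" if "k \<in> {1..n+1}" for k
    using FX[OF that] unfolding U1[OF that] by blast
  have sub': "\<Union>(\<U> (n + 2)) \<subseteq> X"
    using HX layerX unfolding U2 by blast
  have Ud: "family_disjoint \<delta> r (\<U> k)" if "k \<in> {1..n+1}" for k
    unfolding U1[OF that]
  proof (rule family_disjoint_UN)
    show "ereal r < \<delta> x y" if "i \<noteq> j" "x \<in> \<Union>(F k i)" "y \<in> \<Union>(F k j)" for i j x y
      using slabs FX[OF \<open>k \<in> _\<close>] that by blast
  qed (use Fd that in blast)
  have Ud': "family_disjoint \<delta> r (\<U> (n + 2))"
    unfolding U2
  proof (rule family_disjoint_UN)
    fix p q x y
    assume *: "p \<in> {1..n+1} \<times> UNIV" "q \<in> {1..n+1} \<times> UNIV" "p \<noteq> q"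
      "x \<in> \<Union>(case p of (k, j) \<Rightarrow> H k j)" "y \<in> \<Union>(case q of (k, j) \<Rightarrow> H k j)"
    obtain k i l j where pq: "p = (k, i)" "q = (l, j)" by (meson surj_pair)
    have k: "k \<in> {1..n+1}" "l \<in> {1..n+1}" using * pq by auto
    have "x \<in> \<Union>(H k i)" "y \<in> \<Union>(H l j)" using * pq by auto
    then have "x \<in> layer X L (real_of_int i * P) (real_of_int i * P + e) \<inter> strip k i"
      "y \<in> layer X L (real_of_int j * P) (real_of_int j * P + e) \<inter> strip l j"
      using HX[OF k(1), of i] HX[OF k(2), of j] by blast+
    then show "ereal r < \<delta> x y" by (rule strips) (use * pq in blast)
  qed (use Hd in auto)
  have Ub: "family_bounded \<delta> (D1 + 2 * D0 + 2 * r) (\<U> k)" if "k \<in> {1..n+1}" for k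
    unfolding U1[OF that] using Fb[OF that] by (rule family_bounded_UN)
  have Ub': "family_bounded \<delta> (D1 + 2 * D0 + 2 * r) (\<U> (n + 2))"
    unfolding U2
  proof (rule family_bounded_UN, clarify)
    fix k j assume "k \<in> {1..n+1}"
    from Hb[OF this] show "family_bounded \<delta> (D1 + 2 * D0 + 2 * r) (H k j)"
      by (rule family_bounded_mono) (use pos in linarith)
  qed
  have "covered_by (n + 1) X \<delta> r (D1 + 2 * D0 + 2 * r) \<U>"
    unfolding covered_by_def range
  proof
    show "X = (\<Union>i\<in>insert (n + 2) {1..n+1}. \<Union>(\<U> i))"
    proof
      show "X \<subseteq> (\<Union>i\<in>insert (n + 2) {1..n+1}. \<Union>(\<U> i))"
        using cover unfolding UN_insert by blast
      show "(\<Union>i\<in>insert (n + 2) {1..n+1}. \<Union>(\<U> i)) \<subseteq> X"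
        using sub sub' unfolding UN_insert by (intro Un_least UN_least)
    qed
  qed (use Ud Ud' Ub Ub' in blast)
  then show ?thesis by blast
qed

section \<open>Paths and the path pseudometric of a weighted graph\<close>

lemma path_weight_Cons2 [simp]: "path_weight G (u # v # p) = weight G {u, v} + path_weight G (v # p)"
  and path_weight_single [simp]: "path_weight G [u] = 0"
  by (simp_all add: path_weight_def)

text \<open>The vertex \<open>u\<close> occurs in both pieces, so that no edge is lost at the
  junction.\<close>

lemma path_weight_append:
  "path_weight G (p @ u # q) = path_weight G (p @ [u]) + path_weight G (u # q)"
proof (induction p)
  case (Cons v p)
  then show ?case by (cases p) auto
qed simp

lemma path_weight_rev: "path_weight G (rev p) = path_weight G p"
proof (induction p)
  case (Cons u p)
  then show ?case
    by (cases p) (auto simp: path_weight_append[of G _ _ "[u]"] insert_commute)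
qed simp

lemma path_weight_nonneg:
  assumes "\<And>e. e \<in> edges G \<Longrightarrow> 0 \<le> weight G e" "successively (\<lambda>u v. {u, v} \<in> edges G) p"
  shows "0 \<le> path_weight G p"
  using assms(2)
proof (induction p)
  case (Cons u p)
  then show ?case by (cases p) (auto simp: assms(1))
qed (simp add: path_weight_def)

lemma weighted_graph_weight_nonneg: "\<lbrakk>weighted_graph G; e \<in> edges G\<rbrakk> \<Longrightarrow> 0 \<le> weight G e"
  unfolding weighted_graph_def by (force dest: PiE_mem)

lemma wdist_le: "is_path G x p y \<Longrightarrow> wdist G x y \<le> ereal (path_weight G p)"
  unfolding wdist_def by (rule INF_lower) simp

text \<open>Paths do not repeat vertices, so there are finitely many and the infimum is attained; a
  finite bound excludes the empty set of paths, whose infimum is \<open>\<infinity>\<close>.\<close>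

lemma wdist_leE:
  assumes "finite (verts G)" "wdist G x y \<le> ereal r"
  obtains p where "is_path G x p y" "path_weight G p \<le> r"
proof -
  let ?S = "{p. is_path G x p y}" and ?w = "\<lambda>p. ereal (path_weight G p)"
  have fin: "finite ?S"
    by (rule finite_subset[OF _ finite_subset_distinct[OF assms(1)]]) (auto simp: is_path_def)
  have "?S \<noteq> {}"
  proof
    assume "?S = {}"
    then have "wdist G x y = \<infinity>" unfolding wdist_def by (simp add: top_ereal_def)
    with assms(2) show False by simp
  qed
  then have "Min (?w ` ?S) \<in> ?w ` ?S" "Min (?w ` ?S) = Inf (?w ` ?S)"
    using fin by (intro Min_in Min_Inf; simp)+
  then obtain p where "p \<in> ?S" "wdist G x y = ?w p" unfolding wdist_def by fastforce
  then show ?thesis using assms(2) that by simp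
qed

lemma is_path_rev: "is_path G x p y \<Longrightarrow> is_path G y (rev p) x"
  unfolding is_path_def by (auto simp: hd_rev last_rev insert_commute)

lemma wdist_commute: "wdist G x y = wdist G y x"
proof -
  have "wdist G x y \<le> wdist G y x" for x y
    unfolding wdist_def[of G y x]
  proof (rule INF_greatest)
    fix p assume "p \<in> {p. is_path G y p x}"
    then show "wdist G x y \<le> ereal (path_weight G p)"
      using wdist_le[OF is_path_rev, of G y p x] by (simp add: path_weight_rev)
  qed
  then show ?thesis by (simp add: antisym)
qed

lemma is_path_prefix: "is_path G x (p @ u # q) y \<Longrightarrow> is_path G x (p @ [u]) u"
  unfolding is_path_def by (auto simp: successively_append_iff hd_append split: if_splits)

text \<open>The last assumption keeps the joined list \<open>distinct\<close>, as paths must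
  be.\<close>

lemma is_path_join:
  assumes "is_path G x (p1 @ u # p2) y" "is_path G y (q1 @ u # q2) z"
    and "set p1 \<inter> set (u # q2) = {}"
  shows "is_path G x (p1 @ u # q2) z"
  using assms unfolding is_path_def
  by (auto simp: successively_append_iff hd_append split: if_splits)

text \<open>Concatenating two shortest paths may repeat vertices. Instead one follows the first path
  up to its first vertex on the second and continues along the second; the omitted segments have
  nonnegative weight.\<close>

lemma wdist_triangle:
  assumes "weighted_graph G"
  shows "wdist G x z \<le> wdist G x y + wdist G y z"
proof (cases "wdist G x y = \<infinity> \<or> wdist G y z = \<infinity>")
  case False
  have fin: "finite (verts G)" using assms by (simp add: weighted_graph_def)
  note nn = path_weight_nonneg[OF weighted_graph_weight_nonneg[OF assms]]
  have nn': "0 \<le> wdist G u v" for u v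
    unfolding wdist_def by (rule INF_greatest) (auto simp: is_path_def nn)
  from False nn' obtain a b where ab: "wdist G x y = ereal a" "wdist G y z = ereal b"
    by (metis MInfty_neq_ereal(1) ereal_cases ereal_infty_less_eq(2) zero_ereal_def)
  obtain p where p: "is_path G x p y" "path_weight G p \<le> a"
    using wdist_leE[OF fin, of x y a] ab by auto
  obtain q where q: "is_path G y q z" "path_weight G q \<le> b"
    using wdist_leE[OF fin, of y z b] ab by auto
  \<comment> \<open>The vertex \<open>y\<close> ends \<open>p\<close> and begins
    \<open>q\<close>.\<close>
  have "\<exists>u\<in>set p. u \<in> set q"
    using p(1) q(1) unfolding is_path_def by (metis hd_in_set last_in_set)
  then obtain p1 u p2 where p12: "p = p1 @ u # p2" "u \<in> set q" "\<forall>v\<in>set p1. v \<notin> set q"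
    using split_list_first_prop[of p "\<lambda>u. u \<in> set q"] by blast
  then obtain q1 q2 where q12: "q = q1 @ u # q2" by (meson split_list)
  have "is_path G x (p1 @ u # q2) z"
    using is_path_join[of G x p1 u p2 y q1 q2 z] p(1) q(1) p12 q12 by auto
  then have "wdist G x z \<le> ereal (path_weight G (p1 @ [u]) + path_weight G (u # q2))"
    using wdist_le path_weight_append[of G p1 u q2] by metis
  moreover have "path_weight G (p1 @ [u]) \<le> path_weight G p"
    using path_weight_append[of G p1 u p2] p12 nn[of "u # p2"] p(1)
    unfolding is_path_def by (auto simp: successively_append_iff)
  moreover have "path_weight G (u # q2) \<le> path_weight G q"
    using path_weight_append[of G q1 u q2] q12 nn[of "q1 @ [u]"] q(1)
    unfolding is_path_def by (auto simp: successively_append_iff)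
  ultimately show ?thesis unfolding ab using p q by (simp add: order.trans)
qed auto

lemma wdist_self:
  assumes "x \<in> verts G" shows "wdist G x x \<le> 0"
  using wdist_le[of G x "[x]" x] assms by (simp add: is_path_def zero_ereal_def)

lemma pseudometric_wdist: "weighted_graph G \<Longrightarrow> pseudometric (verts G) (wdist G)"
  by unfold_locales (simp_all add: wdist_self wdist_triangle wdist_commute)

section \<open>Intrinsic distances of induced subgraphs, and covers of layers\<close>

lemma path_weight_induced:
  assumes "successively (\<lambda>u v. {u, v} \<in> edges G) p" "set p \<subseteq> B"
  shows "path_weight (induced_wgraph G B) p = path_weight G p"
  using assms
proof (induction p)
  case (Cons u p)
  then show ?case by (cases p) (auto simp: induced_wgraph_def)
qed (simp add: path_weight_def)

lemma is_path_induced_iff: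
  assumes "B \<subseteq> verts G"
  shows "is_path (induced_wgraph G B) x p y \<longleftrightarrow> is_path G x p y \<and> set p \<subseteq> B"
proof -
  have "successively (\<lambda>u v. {u, v} \<in> edges G \<and> {u, v} \<subseteq> B) p \<longleftrightarrow>
      successively (\<lambda>u v. {u, v} \<in> edges G) p" if "set p \<subseteq> B"
    using that by (intro successively_cong) auto
  then show ?thesis using assms unfolding is_path_def induced_wgraph_def by auto
qed

text \<open>The induced graph has fewer paths, with the same weights, so the infimum can only
  grow.\<close>

lemma wdist_le_wdist_induced:
  assumes "B \<subseteq> verts G" shows "wdist G x y \<le> wdist (induced_wgraph G B) x y"
  unfolding wdist_def[of "induced_wgraph G B"]
proof (rule INF_greatest)
  fix p assume "p \<in> {p. is_path (induced_wgraph G B) x p y}"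
  then have p: "is_path G x p y" "set p \<subseteq> B" using is_path_induced_iff[OF assms] by auto
  then have "path_weight (induced_wgraph G B) p = path_weight G p"
    by (intro path_weight_induced) (auto simp: is_path_def)
  then show "wdist G x y \<le> ereal (path_weight (induced_wgraph G B) p)"
    using wdist_le[OF p(1)] by simp
qed

text \<open>Every initial segment of a path of weight at most \<open>r\<close> from \<open>x\<close>
  has weight at most \<open>r\<close>, so \<open>L\<close> stays within \<open>r\<close> of
  \<open>L x\<close> along the path. The path thus remains in \<open>B\<close> and is a path of the
  induced graph.\<close>

lemma wdist_induced_le:
  assumes G: "weighted_graph G" and L: "real_projection G L" and B: "B \<subseteq> verts G"
    and sub: "layer (verts G) L (L x - r) (L x + r) \<subseteq> B" and d: "wdist G x y \<le> ereal r"
  shows "wdist (induced_wgraph G B) x y \<le> ereal r"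
proof -
  have "finite (verts G)" using G by (simp add: weighted_graph_def)
  from this d obtain p where p: "is_path G x p y" "path_weight G p \<le> r" by (rule wdist_leE)
  have "set p \<subseteq> B"
  proof
    fix u assume "u \<in> set p"
    then obtain p1 p2 where p12: "p = p1 @ u # p2" by (meson split_list)
    have "0 \<le> path_weight G (u # p2)"
      using p(1) path_weight_nonneg[OF weighted_graph_weight_nonneg[OF G]] p12
      by (auto simp: is_path_def successively_append_iff)
    then have "path_weight G (p1 @ [u]) \<le> r" using p(2) path_weight_append[of G p1 u p2] p12 by simp
    moreover have "wdist G x u \<le> ereal (path_weight G (p1 @ [u]))"
      using p(1) unfolding p12 by (intro wdist_le is_path_prefix)
    ultimately have "wdist G x u \<le> ereal r" by (meson ereal_less_eq(3) order_trans)
    moreover have V: "x \<in> verts G" "u \<in> verts G"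
      using p(1) \<open>u \<in> set p\<close> unfolding is_path_def by (auto dest: hd_in_set)
    ultimately have "ereal \<bar>L x - L u\<bar> \<le> ereal r"
      using L unfolding real_projection_def by (meson order_trans)
    then have "u \<in> layer (verts G) L (L x - r) (L x + r)" using V by (auto simp: layer_def)
    then show "u \<in> B" using sub by blast
  qed
  then have "is_path (induced_wgraph G B) x p y" using p(1) is_path_induced_iff[OF B] by blast
  moreover have "path_weight (induced_wgraph G B) p = path_weight G p"
    using p(1) \<open>set p \<subseteq> B\<close> by (intro path_weight_induced) (auto simp: is_path_def)
  ultimately show ?thesis using wdist_le p(2) by (metis ereal_less_eq(3) order_trans)
qed

text \<open>Layerability speaks of maximal bounded sets, so a layer has to be enlarged to one before
  it can be used.\<close>

lemma maximal_inf_bounded_superset: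
  assumes "finite (verts G)" "A \<subseteq> verts G" "inf_bounded L S A"
  obtains B where "A \<subseteq> B" "maximal_inf_bounded G L S B"
proof -
  let ?\<B> = "{B. B \<subseteq> verts G \<and> inf_bounded L S B}"
  have "finite ?\<B>" using assms(1) by simp
  moreover have "A \<in> ?\<B>" using assms by simp
  ultimately have "\<exists>B\<in>?\<B>. A \<subseteq> B \<and> (\<forall>C\<in>?\<B>. B \<subseteq> C \<longrightarrow> B = C)"
    by (rule finite_has_maximal2)
  then obtain B where B: "B \<in> ?\<B>" "A \<subseteq> B" and max: "\<forall>C\<in>?\<B>. B \<subseteq> C \<longrightarrow> B = C"
    by (elim bexE conjE)
  have "maximal_inf_bounded G L S B"
    unfolding maximal_inf_bounded_def using B(1) max[rule_format, symmetric] by simp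
  with B(2) show ?thesis by (rule that)
qed

text \<open>The layer thickened by \<open>r\<close> on both sides has spread at most
  \<open>S + 2 * r\<close> and lies in a maximal set \<open>B\<close>. A cover of \<open>B\<close>
  in its intrinsic metric is intersected with the layer: bounds pass to \<open>G\<close> because
  distances in \<open>G\<close> are no larger, and \<open>r\<close>-disjointness passes because
  short paths from the layer stay in \<open>B\<close>.\<close>

lemma layer_cover:
  assumes G: "weighted_graph G" and L: "real_projection G L" and pos: "0 < S" "0 < r"
    and ind: "\<And>A. maximal_inf_bounded G L (S + 2 * r) A \<Longrightarrow>
      control_function n (verts (induced_wgraph G A)) (wdist (induced_wgraph G A)) D"
  shows "\<exists>\<U>. covered_by n (layer (verts G) L t (t + S)) (wdist G) r (D r) \<U>"
proof -
  have fin: "finite (verts G)" using G by (simp add: weighted_graph_def)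
  define A where "A = layer (verts G) L t (t + S)"
  have "inf_bounded L (S + 2 * r) (layer (verts G) L (t - r) (t + S + r))"
    unfolding inf_bounded_def layer_def by auto
  moreover have "layer (verts G) L (t - r) (t + S + r) \<subseteq> verts G" unfolding layer_def by blast
  ultimately obtain B where B: "layer (verts G) L (t - r) (t + S + r) \<subseteq> B"
    and max: "maximal_inf_bounded G L (S + 2 * r) B"
    using maximal_inf_bounded_superset[OF fin] by metis
  have BV: "B \<subseteq> verts G" using max unfolding maximal_inf_bounded_def by blast
  have AB: "A \<subseteq> B" using B pos unfolding A_def layer_def by auto
  let ?I = "induced_wgraph G B"
  have "verts ?I = B" by (simp add: induced_wgraph_def)
  then obtain \<U> where \<U>: "covered_by n B (wdist ?I) r (D r) \<U>"
    using ind[OF max] pos unfolding control_function_iff by auto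
  have "family_disjoint (wdist G) r ((\<lambda>U. U \<inter> A) ` \<U> i)" if "i \<in> {1..n+1}" for i
    unfolding family_disjoint_def
  proof (intro ballI impI, elim imageE)
    fix U' V' x y U V
    assume *: "U' \<noteq> V'" "x \<in> U'" "y \<in> V'" "U' = U \<inter> A" "V' = V \<inter> A" "U \<in> \<U> i" "V \<in> \<U> i"
    have "ereal r < wdist ?I x y"
      using \<U> that * unfolding covered_by_def family_disjoint_def by blast
    moreover have "layer (verts G) L (L x - r) (L x + r) \<subseteq> B"
      using B * unfolding A_def layer_def by auto
    ultimately show "ereal r < wdist G x y"
      using wdist_induced_le[OF G L BV] by (meson not_less)
  qed
  moreover have "family_bounded (wdist G) (D r) ((\<lambda>U. U \<inter> A) ` \<U> i)" if "i \<in> {1..n+1}" for i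
  proof (rule family_bounded_image_Int)
    show "family_bounded (wdist G) (D r) (\<U> i)"
      using \<U> that wdist_le_wdist_induced[OF BV] unfolding covered_by_def family_bounded_def
      by (meson order_trans)
  qed
  moreover have "A = (\<Union>i\<in>{1..n+1}. \<Union>((\<lambda>U. U \<inter> A) ` \<U> i))"
    using \<U> AB unfolding covered_by_def by blast
  ultimately have "covered_by n A (wdist G) r (D r) (\<lambda>i. (\<lambda>U. U \<inter> A) ` \<U> i)"
    unfolding covered_by_def by blast
  then show ?thesis unfolding A_def by blast
qed

section \<open>The control function of the layered class, its linear bounds, and the theorem\<close>

text \<open>Here \<open>e\<close> is the height of a row. The two arguments of \<open>f\<close> are
  this height thickened on both sides by the scale in use, \<open>r\<close> for even rows and
  \<open>r1\<close> for odd rows; the result is the bound of \<open>cover_of_layers\<close>.\<close>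

definition layered_control :: "nat \<Rightarrow> (real \<Rightarrow> nat) \<Rightarrow> (nat \<Rightarrow> real \<Rightarrow> real) \<Rightarrow> real \<Rightarrow> real" where
  "layered_control n f D r =
     (let e = 4 * (real n + 1) * r; D0 = D (f (e + 2 * r)) r; r1 = 2 * D0 + 3 * r
      in D (f (e + 2 * r1)) r1 + 2 * D0 + 2 * r)"

text \<open>The function \<open>f\<close> is common to all graphs of \<open>\<C>\<close>, and each
  class \<open>\<L> (f S)\<close> has one control function for all its members, so the bound from
  the gluing does not depend on the graph.\<close>

lemma class_control_function_layered:
  assumes C: "\<forall>G\<in>\<C>. weighted_graph G" and lay: "layerable_via f \<L> \<C>"
    and D: "\<And>i. 1 \<le> i \<Longrightarrow> class_control_function n (\<L> i) (D i)"
  shows "class_control_function (n + 1) \<C> (layered_control n f D)"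
proof -
  have f1: "1 \<le> f S" if "0 < S" for S using lay that unfolding layerable_via_def by blast
  have Dpos: "0 < D i r" if "1 \<le> i" "0 < r" for i r
    using D[OF that(1)] that(2) unfolding class_control_function_def by blast
  define D0 where "D0 r = D (f (4 * (real n + 1) * r + 2 * r)) r" for r
  define r1 where "r1 r = 2 * D0 r + 3 * r" for r
  define D1 where "D1 r = D (f (4 * (real n + 1) * r + 2 * r1 r)) (r1 r)" for r
  have lc: "layered_control n f D r = D1 r + 2 * D0 r + 2 * r" for r
    by (simp add: layered_control_def D0_def r1_def D1_def Let_def)
  have D0: "0 < D0 r" and r1: "0 < r1 r" and D1: "0 < D1 r" if "0 < r" for r
  proof -
    show 1: "0 < D0 r" unfolding D0_def using that by (intro Dpos f1 add_pos_pos) auto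
    show 2: "0 < r1 r" unfolding r1_def using 1 that by simp
    show "0 < D1 r" unfolding D1_def using 2 that by (intro Dpos f1 add_pos_pos) auto
  qed
  have pos: "0 < layered_control n f D r" if "0 < r" for r
    unfolding lc using D0 D1 that by (intro add_pos_pos) auto
  have "\<exists>\<U>. covered_by (n + 1) (verts G) (wdist G) r (layered_control n f D r) \<U>"
    if G: "G \<in> \<C>" and r: "0 < r" for G r
  proof -
    have wg: "weighted_graph G" using C G by blast
    interpret pseudometric "verts G" "wdist G" by (rule pseudometric_wdist[OF wg])
    obtain L where L: "real_projection G L"
      and max: "\<And>S A. \<lbrakk>0 < S; maximal_inf_bounded G L S A\<rbrakk> \<Longrightarrow> induced_wgraph G A \<in> \<L> (f S)"
      using lay G unfolding layerable_via_def by blast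
    have layers: "\<exists>\<U>. covered_by n (layer (verts G) L t (t + S)) (wdist G) s
        (D (f (S + 2 * s)) s) \<U>"
      if "0 < S" "0 < s" for t S s
    proof (rule layer_cover[OF wg L that, where D = "D (f (S + 2 * s))"])
      fix A assume A: "maximal_inf_bounded G L (S + 2 * s) A"
      have S: "0 < S + 2 * s" using that by simp
      show "control_function n (verts (induced_wgraph G A)) (wdist (induced_wgraph G A))
          (D (f (S + 2 * s)))"
        using D[OF f1[OF S]] max[OF S A] unfolding class_control_function_def by blast
    qed
    define e where "e = 4 * (real n + 1) * r"
    have e: "0 < e" using r by (simp add: e_def)
    \<comment> \<open>Covers are chosen for every real starting level \<open>t\<close>; the gluing
      then takes those at the lower ends of the rows.\<close>
    obtain UE where UE:
      "\<And>t. covered_by n (layer (verts G) L t (t + e)) (wdist G) r (D0 r) (UE t)"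
      using layers[OF e r] unfolding D0_def e_def by metis
    obtain VO where VO:
      "\<And>t. covered_by n (layer (verts G) L t (t + e)) (wdist G) (r1 r) (D1 r) (VO t)"
      using layers[OF e r1[OF r]] unfolding D1_def e_def by metis
    have "\<exists>\<U>. covered_by (n + 1) (verts G) (wdist G) r (D1 r + 2 * D0 r + 2 * r) \<U>"
    proof (rule cover_of_layers)
      show "ereal \<bar>L x - L y\<bar> \<le> wdist G x y" if "x \<in> verts G" "y \<in> verts G" for x y
        using L that unfolding real_projection_def by blast
      fix j :: int
      let ?P = "2 * (4 * (real n + 1) * r)"
      show "covered_by n (layer (verts G) L (real_of_int j * ?P)
          (real_of_int j * ?P + 4 * (real n + 1) * r)) (wdist G) r (D0 r) (UE (real_of_int j * ?P))"
        using UE unfolding e_def .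
      show "covered_by n (layer (verts G) L (real_of_int j * ?P + 4 * (real n + 1) * r)
          (real_of_int j * ?P + 4 * (real n + 1) * r + 4 * (real n + 1) * r)) (wdist G)
          (2 * D0 r + 3 * r) (D1 r) (VO (real_of_int j * ?P + 4 * (real n + 1) * r))"
        using VO unfolding e_def r1_def .
    qed (use D0[OF r] D1[OF r] r in auto)
    then show ?thesis unfolding lc .
  qed
  then show ?thesis
    unfolding class_control_function_def control_function_iff using pos by blast
qed

text \<open>The constant term is kept as a multiple of \<open>d\<close>, so that one estimate gives
  linear type in general and a purely linear bound when \<open>d = 0\<close>.\<close>

lemma layered_control_le:
  assumes nn: "0 \<le> a" "0 \<le> b" "0 \<le> c" "0 \<le> d"
    and f: "\<And>S. 0 < S \<Longrightarrow> 1 \<le> f S \<and> real (f S) \<le> max (c * S) 1"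
    and D: "\<And>i r. \<lbrakk>1 \<le> i; 0 < r\<rbrakk> \<Longrightarrow> 0 < D i r \<and> D i r \<le> a * r + b * (real i - 1) + d"
  shows "\<exists>K\<ge>0. \<exists>K'\<ge>0. \<forall>r>0. layered_control n f D r \<le> K * r + K' * d"
proof -
  define q where "q = b * c"
  define m where "m = 4 * (real n + 1)"
  \<comment> \<open>\<open>A\<close> is the slope in \<open>r\<close> of the bound on the even rows,
    whose layers have thickened height \<open>(m + 2) * r\<close>; \<open>B\<close> is the slope in
    \<open>r1\<close> of the bound on the odd rows.\<close>
  define A where "A = a + q * (m + 2)"
  define B where "B = a + 2 * q"
  have q: "0 \<le> q" "0 \<le> m" "0 \<le> A" "0 \<le> B" using nn by (simp_all add: q_def m_def A_def B_def)
  \<comment> \<open>Here the shift in \<open>i - 1\<close> matters: \<open>max (c * S) 1 - 1\<close>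
    is at most \<open>c * S\<close>, so the class index contributes \<open>q * S\<close> and no
    additive constant.\<close>
  have DS: "D (f S) s \<le> a * s + q * S + d" if "0 < S" "0 < s" for S s
  proof -
    have "0 \<le> c * S" using that nn by simp
    then have "real (f S) - 1 \<le> c * S" using f[OF that(1)] by linarith
    then have "b * (real (f S) - 1) \<le> b * (c * S)" using nn by (intro mult_left_mono)
    then show ?thesis using D[of "f S" s] f[OF that(1)] that(2) by (auto simp: q_def mult.assoc)
  qed
  have "layered_control n f D r \<le> (B * (2 * A + 3) + q * m + 2 * A + 2) * r + (2 * B + 3) * d"
    if r: "0 < r" for r
  proof -
    define D0 where "D0 = D (f (m * r + 2 * r)) r"
    define r1 where "r1 = 2 * D0 + 3 * r"
    define D1 where "D1 = D (f (m * r + 2 * r1)) r1"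
    have mr: "0 \<le> m * r" using q r by simp
    have "0 < m * r + 2 * r" using mr r by linarith
    then have D0: "0 < D0" "D0 \<le> A * r + d"
      unfolding D0_def using D[of "f (m * r + 2 * r)" r] f DS[of "m * r + 2 * r" r] r
      by (auto simp: A_def algebra_simps)
    then have r1: "0 < r1" "r1 \<le> (2 * A + 3) * r + 2 * d"
      unfolding r1_def using r by (auto simp: algebra_simps)
    have "0 < m * r + 2 * r1" using mr r1 by linarith
    then have "D1 \<le> B * r1 + q * m * r + d"
      unfolding D1_def using DS[of "m * r + 2 * r1" r1] r1 by (simp add: B_def algebra_simps)
    also have "B * r1 \<le> B * ((2 * A + 3) * r + 2 * d)" using q r1 by (intro mult_left_mono)
    finally have "D1 + 2 * D0 + 2 * r
        \<le> (B * (2 * A + 3) + q * m + 2 * A + 2) * r + (2 * B + 3) * d"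
      using D0 by (simp add: algebra_simps)
    moreover have "layered_control n f D r = D1 + 2 * D0 + 2 * r"
      by (simp add: layered_control_def D0_def r1_def D1_def Let_def m_def)
    ultimately show ?thesis by simp
  qed
  moreover have "0 \<le> B * (2 * A + 3) + q * m + 2 * A + 2" "0 \<le> 2 * B + 3"
    using q by (simp_all add: add_nonneg_nonneg)
  ultimately show ?thesis by blast
qed

theorem theorem4p3:
  fixes \<L> :: "nat \<Rightarrow> 'a wgraph set" and \<C> :: "'a wgraph set" and n :: nat
  assumes "\<forall>i\<ge>1. \<forall>G\<in>\<L> i. weighted_graph G"
    and "\<forall>i\<ge>1. \<L> i \<subseteq> \<L> (i + 1)"
    and "\<forall>i\<ge>1. asdim_at_most n (\<L> i)"
    and "\<forall>G\<in>\<C>. weighted_graph G"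
    and "layerable \<L> \<C>"
  shows "asdim_at_most (n + 1) \<C> \<and>
    (\<forall>c>0. linearly_layerable c \<L> \<C> \<longrightarrow>
      (\<forall>a b d :: real. a \<ge> 0 \<and> b \<ge> 0 \<and> d \<ge> 0 \<and>
        (\<forall>i\<ge>1. \<exists>D. class_control_function n (\<L> i) D \<and>
           (\<forall>r>0. D r \<le> a * r + b * (real i - 1) + d)) \<longrightarrow>
        asdim_at_most_linear_type (n + 1) \<C> \<and>
        (d = 0 \<longrightarrow> assouad_nagata_dim_at_most (n + 1) \<C>)))"
proof (intro conjI allI impI; (elim conjE)?)
  obtain f where f: "layerable_via f \<L> \<C>" using assms(5) unfolding layerable_def by blast
  obtain D where "\<And>i. 1 \<le> i \<Longrightarrow> class_control_function n (\<L> i) (D i)"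
    using assms(3) unfolding asdim_at_most_def by metis
  from class_control_function_layered[OF assms(4) f this]
  show "asdim_at_most (n + 1) \<C>" unfolding asdim_at_most_def by blast
next
  fix c a b d :: real
  assume c: "0 < c" and lin: "linearly_layerable c \<L> \<C>"
    and nn: "0 \<le> a" "0 \<le> b" "0 \<le> d"
    and ctrl: "\<forall>i\<ge>1. \<exists>D. class_control_function n (\<L> i) D \<and>
           (\<forall>r>0. D r \<le> a * r + b * (real i - 1) + d)"
  \<comment> \<open>Both \<open>f\<close> and \<open>D\<close> are chosen anew, now with their
    linear bounds, and the same control function serves the two remaining conclusions.\<close>
  obtain f where f: "layerable_via f \<L> \<C>" and fS: "\<And>S. 0 < S \<Longrightarrow> real (f S) \<le> max (c * S) 1"
    using lin unfolding linearly_layerable_def by blast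
  obtain D where D: "\<And>i. 1 \<le> i \<Longrightarrow> class_control_function n (\<L> i) (D i)"
    and Dle: "\<And>i r. \<lbrakk>1 \<le> i; 0 < r\<rbrakk> \<Longrightarrow> D i r \<le> a * r + b * (real i - 1) + d"
    using ctrl by metis
  note ccf = class_control_function_layered[OF assms(4) f D]
  have "1 \<le> f S \<and> real (f S) \<le> max (c * S) 1" if "0 < S" for S
    using f fS[OF that] that unfolding layerable_via_def by blast
  moreover have "0 < D i r \<and> D i r \<le> a * r + b * (real i - 1) + d" if "1 \<le> i" "0 < r" for i r
    using D[OF that(1)] Dle[OF that] that(2) unfolding class_control_function_def by blast
  ultimately obtain K K' where K: "0 \<le> K" "0 \<le> K'"
    and le: "\<And>r. 0 < r \<Longrightarrow> layered_control n f D r \<le> K * r + K' * d"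
    using layered_control_le[of a b c d f D n] nn c by auto
  have Kd: "0 \<le> K' * d" using K nn by simp
  show "asdim_at_most_linear_type (n + 1) \<C>"
    unfolding asdim_at_most_linear_type_def
  proof (intro exI conjI allI impI)
    \<comment> \<open>A single constant has to dominate both slope and intercept; the summand
      \<open>1\<close> makes it positive.\<close>
    show "0 < K + K' * d + 1" using K Kd by linarith
    fix r :: real assume r: "0 < r"
    have "0 \<le> (K' * d + 1) * r" using Kd r by simp
    then show "layered_control n f D r \<le> (K + K' * d + 1) * r + (K + K' * d + 1)"
      using le[OF r] K by (simp add: algebra_simps)
  qed (rule ccf)
  show "assouad_nagata_dim_at_most (n + 1) \<C>" if "d = 0"
    unfolding assouad_nagata_dim_at_most_def
  proof (intro exI conjI allI impI)
    show "0 < K + 1" using K by linarith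
    fix r :: real assume r: "0 < r"
    then show "layered_control n f D r \<le> (K + 1) * r"
      using le[OF r] that by (simp add: algebra_simps)
  qed (rule ccf)
qed

end
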